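(* Let $S$ be a finite non-commutative completely simple semigroup. Then the commuting graph $\mathcal{G}(S)$ has no left paths.
   Context: The center of a semigroup $S$ is $Z(S)=\{x\in S: xy=yx\text{ for all }y\in S\}$. For a finite non-commutative semigroup $S$, the commuting graph $\mathcal{G}(S)$ is the simple graph with vertex set $S\setminus Z(S)$ in which two distinct vertices $x,y$ are adjacent if and only if $xy=yx$. A left path in $\mathcal{G}(S)$ is a path $x_1,\ldots,x_n$ in $\mathcal{G}(S)$ such that $x_1\neq x_n$ and $x_1x_i=x_nx_i$ for all $i\in\{1,\ldots,n\}$. Here a path is a sequence of vertices, pairwise distinct except possibly for the first and last ones, in which consecutive vertices are joined by edges and these edges are pairwise distinct. A semigroup without a zero is completely simple if it contains no proper ideals and it contains a minimal idempotent (minimal for the partial order on idempotents given by $e\leqslant f$ if and only if $ef=fe=e$). *)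

theory Defs
  imports "Graph_Theory.Pair_Digraph" "Graph_Theory.Vertex_Walk"
begin

text \<open>The semigroup \<open>S\<close> is the whole of a type of class \<^class>\<open>semigroup_mult\<close>.\<close>

definition semigroup_center :: "'a::semigroup_mult set" where
  "semigroup_center = {x. \<forall>y. x * y = y * x}"

text \<open>An undirected edge is represented, as usual in this graph library, by its two opposite
  arcs.\<close>

definition commuting_graph :: "'a::semigroup_mult pair_pre_digraph" where
  "commuting_graph =
     \<lparr> pverts = UNIV - semigroup_center,
       parcs = {(x, y). x \<notin> semigroup_center \<and> y \<notin> semigroup_center \<and> x \<noteq> y \<and> x * y = y * x} \<rparr>"

lemma pair_graph_commuting_graph:
  "pair_graph (commuting_graph :: 'a::{finite, semigroup_mult} pair_pre_digraph)"
  by unfold_locales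
    (auto simp: commuting_graph_def arcs_ends_conv symmetric_def with_proj_def intro!: symI)

text \<open>Closed paths are allowed. The last condition says that the edges are pairwise distinct as
  undirected edges; it excludes \<open>[x, y, x]\<close>.\<close>

definition graph_path :: "'a list \<Rightarrow> 'a pair_pre_digraph \<Rightarrow> bool" where
  "graph_path p G \<longleftrightarrow>
     vwalk p (with_proj G) \<and>
     (\<forall>i j. i < j \<and> j < length p \<and> p ! i = p ! j \<longrightarrow> i = 0 \<and> j = length p - 1) \<and>
     distinct (map (\<lambda>(x, y). {x, y}) (vwalk_arcs p))"

definition left_path :: "'a::semigroup_mult list \<Rightarrow> bool" where
  "left_path p \<longleftrightarrow>
     graph_path p commuting_graph \<and> hd p \<noteq> last p \<and> (\<forall>x\<in>set p. hd p * x = last p * x)"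

definition has_zero :: "'a::semigroup_mult itself \<Rightarrow> bool" where
  "has_zero T \<longleftrightarrow> (\<exists>z::'a. \<forall>x. z * x = z \<and> x * z = z)"

definition semigroup_ideal :: "'a::semigroup_mult set \<Rightarrow> bool" where
  "semigroup_ideal I \<longleftrightarrow> I \<noteq> {} \<and> (\<forall>x\<in>I. \<forall>s. s * x \<in> I \<and> x * s \<in> I)"

definition idempotent_elem :: "'a::semigroup_mult \<Rightarrow> bool" where
  "idempotent_elem e \<longleftrightarrow> e * e = e"

definition idem_le :: "'a::semigroup_mult \<Rightarrow> 'a \<Rightarrow> bool" where
  "idem_le e f \<longleftrightarrow> e * f = e \<and> f * e = e"

definition minimal_idempotent :: "'a::semigroup_mult \<Rightarrow> bool" where
  "minimal_idempotent e \<longleftrightarrow>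
     idempotent_elem e \<and> (\<forall>f. idempotent_elem f \<and> idem_le f e \<longrightarrow> f = e)"

definition completely_simple :: "'a::semigroup_mult itself \<Rightarrow> bool" where
  "completely_simple T \<longleftrightarrow>
     \<not> has_zero T \<and>
     \<not> (\<exists>I::'a set. semigroup_ideal I \<and> I \<noteq> UNIV) \<and>
     (\<exists>e::'a. minimal_idempotent e)"

end

theory Submission
  imports Defs
begin

text \<open>
  In a finite semigroup without proper ideals, commuting elements generate the same principal left
  ideal. Indeed the ideal generated by \<open>b * a\<close> contains \<open>a\<close>, and in a finite semigroup such a
  two-sided factorization of \<open>a\<close> can be made one-sided, which gives \<open>a = w * (b * a)\<close>; if \<open>a\<close> and
  \<open>b\<close> commute, then \<open>a\<close> is a left multiple of \<open>b\<close>. Hence, along a path of the commuting graph, the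
  last vertex \<open>y\<close> is a left multiple of the first vertex \<open>x\<close>.

  The condition of a left path at the vertex \<open>x\<close> itself says \<open>x * x = y * x\<close>. By the dual absorption
  law, \<open>x = x * x * w\<close> for some \<open>w\<close>. So right multiplication by \<open>x * w\<close> fixes \<open>x\<close>, hence also its
  left multiple \<open>y\<close>, and sends \<open>x\<close> and \<open>y\<close> to the same element. Thus \<open>x = y\<close>, whereas the ends of
  a left path are distinct. In terms of the structure theory, all vertices of the path lie in one
  maximal subgroup, where cancellation holds.
\<close>

text \<open>
  This is the stability of finite semigroups: the principal right ideal of \<open>a\<close> contains that of
  \<open>a \<^bold>* z\<close>, but left multiplication by \<open>u\<close> maps the latter onto the former, so finiteness forces
  them to be equal. The operation is abstract so that the lemma also applies to the
  opposite semigroup.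
\<close>

lemma (in semigroup) finite_imp_right_absorption:
  assumes fin: "finite (UNIV :: 'a set)" and fact: "a = u \<^bold>* (a \<^bold>* z)"
  shows "a = a \<^bold>* z \<or> (\<exists>w. a = a \<^bold>* z \<^bold>* w)"
proof -
  define R where "R c = insert c (range (\<lambda>s. c \<^bold>* s))" for c
  have sub: "R (a \<^bold>* z) \<subseteq> R a"
    by (auto simp: R_def assoc)
  have "u \<^bold>* (a \<^bold>* z \<^bold>* s) = a \<^bold>* s" for s
    by (metis fact assoc)
  hence "R a \<subseteq> (\<lambda>t. u \<^bold>* t) ` R (a \<^bold>* z)"
    using fact by (auto simp: R_def image_iff)
  hence "card (R a) \<le> card (R (a \<^bold>* z))"
    by (meson fin finite_subset subset_UNIV surj_card_le)
  hence "R (a \<^bold>* z) = R a"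
    using sub by (meson card_seteq fin finite_subset subset_UNIV)
  hence "a \<in> R (a \<^bold>* z)"
    by (simp add: R_def)
  thus ?thesis
    by (auto simp: R_def)
qed

text \<open>The multiples \<open>u * c * v\<close> of \<open>c\<close> form an ideal, so they exhaust the semigroup.\<close>

lemma factorization_if_no_proper_ideal:
  assumes "\<not> (\<exists>I :: 'a::semigroup_mult set. semigroup_ideal I \<and> I \<noteq> UNIV)"
  shows "\<exists>u v. a = u * c * (v :: 'a)"
proof -
  have "semigroup_ideal {u * c * v | u v. True}"
    unfolding semigroup_ideal_def by (auto, metis mult.assoc, metis mult.assoc)
  hence "a \<in> {u * c * v | u v. True}"
    using assms by blast
  thus ?thesis by blast
qed

lemma right_absorption:
  assumes "\<not> (\<exists>I :: 'a::{finite, semigroup_mult} set. semigroup_ideal I \<and> I \<noteq> UNIV)"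
  shows "\<exists>w. a = a * b * (w :: 'a)"
proof -
  obtain u v where "a = u * (a * b) * v"
    using factorization_if_no_proper_ideal[OF assms] by blast
  hence "a = u * (a * (b * v))"
    by (simp add: mult.assoc)
  from mult.finite_imp_right_absorption[OF finite_UNIV this] show ?thesis
    by (metis mult.assoc)
qed

lemma left_absorption:
  assumes "\<not> (\<exists>I :: 'a::{finite, semigroup_mult} set. semigroup_ideal I \<and> I \<noteq> UNIV)"
  shows "\<exists>w. a = (w :: 'a) * (b * a)"
proof -
  interpret opposite: semigroup "\<lambda>x y :: 'a. y * x"
    by unfold_locales (simp add: mult.assoc)
  obtain u v where "a = u * (b * a) * v"
    using factorization_if_no_proper_ideal[OF assms] by blast
  hence "a = ((u * b) * a) * v"
    by (simp add: mult.assoc)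
  from opposite.finite_imp_right_absorption[OF finite_UNIV this] show ?thesis
    by (metis mult.assoc)
qed

text \<open>
  If \<open>x\<close> and \<open>y\<close> commute, absorption on the left gives \<open>y = w * (x * y) = w * y * x\<close>,
  a left multiple of \<open>x\<close>; being a left multiple is transitive along the walk.
\<close>

lemma last_left_multiple_of_hd:
  assumes "\<not> (\<exists>I :: 'a::{finite, semigroup_mult} set. semigroup_ideal I \<and> I \<noteq> UNIV)"
    and "vwalk p (with_proj (commuting_graph :: 'a pair_pre_digraph))"
  shows "\<exists>s. last p = s * hd p"
  using assms(2)
proof (induction p rule: induct_list012)
  case 1
  thus ?case by (simp add: vwalk_def)
next
  case (2 x)
  show ?case
    using left_absorption[OF assms(1), of x x] by (metis last.simps list.sel(1) mult.assoc)
next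
  case (3 x y p)
  have "vwalk (y # p) (with_proj (commuting_graph :: 'a pair_pre_digraph))"
    and comm: "x * y = y * x"
    using "3.prems" by (auto simp: vwalk_def commuting_graph_def arcs_ends_conv)
  then obtain s where s: "last (y # p) = s * y"
    using "3.IH" by auto
  obtain w where "y = w * (x * y)"
    using left_absorption[OF assms(1)] by blast
  hence "last (y # p) = s * w * y * x"
    using s comm by (metis mult.assoc)
  thus ?case by auto
qed

theorem corollary4p5:
  assumes noncommutative: "\<not> (\<forall>x y :: 'a::{finite, semigroup_mult}. x * y = y * x)"
    and "completely_simple TYPE('a)"
  shows "\<not> (\<exists>p :: 'a list. left_path p)"
proof
  assume "\<exists>p :: 'a list. left_path p"
  then obtain p :: "'a list"
    where walk: "vwalk p (with_proj (commuting_graph :: 'a pair_pre_digraph))"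
      and ends: "hd p \<noteq> last p"
      and eq: "\<forall>x\<in>set p. hd p * x = last p * x"
    by (auto simp: left_path_def graph_path_def)
  have simple: "\<not> (\<exists>I :: 'a set. semigroup_ideal I \<and> I \<noteq> UNIV)"
    using assms(2) by (simp add: completely_simple_def)
  define x y where "x = hd p" and "y = last p"
  have "p \<noteq> []"
    using walk by (auto simp: vwalk_def)
  hence xx: "x * x = y * x"
    using eq by (simp add: x_def y_def)
  obtain w where w: "x = x * x * w"
    using right_absorption[OF simple] by blast
  obtain s where s: "y = s * x"
    using last_left_multiple_of_hd[OF simple walk] by (auto simp: x_def y_def)
  have "x = y * x * w"
    using w xx by simp
  also have "\<dots> = s * (x * x * w)"
    by (simp add: s mult.assoc)
  also have "\<dots> = y"
    using w s by simp
  finally show False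
    using ends by (simp add: x_def y_def)
qed

end
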